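(* $\mathsf{CWO}_2 \leq_W \mathsf{ATR}_2$.
   Context: Problems are (possibly partial) multivalued functions between represented spaces. $P\leq_W Q$: there are computable partial $\Phi,\Psi:\subseteq\mathbb{N}^\mathbb{N}\to\mathbb{N}^\mathbb{N}$ such that for each name $p$ of a $P$-instance, $\Phi(p)$ names a $Q$-instance, and for each name $q$ of a $Q$-solution to it, $\Psi(p\oplus q)$ names a $P$-solution of $p$. Linear orderings on subsets of $\mathbb{N}$ are represented by $\{\langle a,b\rangle: a\leq_L b\}$. $\mathsf{CWO}_2$: given linear orderings $L$ and $M$, either produce an embedding from one of them onto an initial segment of the other, or an infinite descending sequence in either ordering, with an indication of which type of solution is produced. A jump hierarchy on a linear ordering $L$ with first element $0_L$ starting with $A$ is $\langle X_a\rangle_{a\in L}$ with $X_{0_L}=A$ and $X_b=(\bigoplus_{a<_Lb}X_a)'$ for $b>_L0_L$. $\mathsf{ATR}_2$: given a linear ordering $L$ and $A\subseteq\mathbb{N}$, produce either an infinite $<_L$-descending sequence or a jump hierarchy on $L$ starting with $A$, with an indication of which type of solution is produced. *)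

theory Defs
  imports Complex_Main "HOL-Library.Nat_Bijection"
begin

section \<open>Computability relative to an oracle\<close>

type_synonym baire = "nat \<Rightarrow> nat"

text \<open>
  Partial recursive functions relative to an oracle in Baire space, presented as unary functions:
  several arguments are packed with the Cantor pairing \<open>prod_encode\<close>.
\<close>

datatype prog =
    Zero | Succ | Fst | Snd | Oracle
  | Pair prog prog | Comp prog prog | PrimRec prog prog | Mu prog

text \<open>
  \<open>run p c x\<close> is the value of program \<open>c\<close> with oracle \<open>p\<close> at input \<open>x\<close>, and \<open>None\<close> if the
  computation diverges. \<open>PrimRec f g\<close> recurses on the second component of its input. Minimization
  \<open>Mu f\<close> needs all values of \<open>f\<close> before the first zero to be defined.
\<close>

primrec run :: "baire \<Rightarrow> prog \<Rightarrow> nat \<Rightarrow> nat option" where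
  "run p Zero x = Some 0"
| "run p Succ x = Some (Suc x)"
| "run p Fst x = Some (fst (prod_decode x))"
| "run p Snd x = Some (snd (prod_decode x))"
| "run p Oracle x = Some (p x)"
| "run p (Pair f g) x =
     Option.bind (run p f x) (\<lambda>a. Option.bind (run p g x) (\<lambda>b. Some (prod_encode (a, b))))"
| "run p (Comp f g) x = Option.bind (run p g x) (run p f)"
| "run p (PrimRec f g) x =
     rec_nat (run p f (fst (prod_decode x)))
       (\<lambda>n r. Option.bind r
          (\<lambda>y. run p g (prod_encode (fst (prod_decode x), prod_encode (n, y)))))
       (snd (prod_decode x))"
| "run p (Mu f) x =
     (if \<exists>n. run p f (prod_encode (x, n)) = Some 0 \<and>
             (\<forall>m<n. \<exists>k. run p f (prod_encode (x, m)) = Some (Suc k))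
      then Some (LEAST n. run p f (prod_encode (x, n)) = Some 0)
      else None)"

primrec code :: "prog \<Rightarrow> nat" where
  "code Zero = prod_encode (0, 0)"
| "code Succ = prod_encode (1, 0)"
| "code Fst = prod_encode (2, 0)"
| "code Snd = prod_encode (3, 0)"
| "code Oracle = prod_encode (4, 0)"
| "code (Pair f g) = prod_encode (5, prod_encode (code f, code g))"
| "code (Comp f g) = prod_encode (6, prod_encode (code f, code g))"
| "code (PrimRec f g) = prod_encode (7, prod_encode (code f, code g))"
| "code (Mu f) = prod_encode (8, code f)"

lemma code_inject: "code c = code d \<longleftrightarrow> c = d"
proof (induction c arbitrary: d)
  case Zero then show ?case by (cases d) auto
next
  case Succ then show ?case by (cases d) auto
next
  case Fst then show ?case by (cases d) auto
next
  case Snd then show ?case by (cases d) auto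
next
  case Oracle then show ?case by (cases d) auto
next
  case (Pair f g) then show ?case by (cases d) auto
next
  case (Comp f g) then show ?case by (cases d) auto
next
  case (PrimRec f g) then show ?case by (cases d) auto
next
  case (Mu f) then show ?case by (cases d) auto
qed

definition char_fun :: "nat set \<Rightarrow> baire" where
  "char_fun A n = (if n \<in> A then 1 else 0)"

text \<open>
  The Turing jump. A number that is not the code of a program counts as an index of the nowhere
  defined function.
\<close>

definition turing_jump :: "nat set \<Rightarrow> nat set" where
  "turing_jump A = {code c | c. run (char_fun A) c (code c) \<noteq> None}"

text \<open>
  As usual for functionals used as realizers, the program has to be correct on the domain of
  \<open>F\<close>; nothing is required of it elsewhere.
\<close>

definition computable :: "(baire \<rightharpoonup> baire) \<Rightarrow> bool" where
  "computable F \<longleftrightarrow> (\<exists>c. \<forall>p r. F p = Some r \<longrightarrow> (\<forall>n. run p c n = Some (r n)))"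


section \<open>Represented spaces\<close>

text \<open>A representation \<open>\<delta>\<close> is a partial function from names onto the represented space \<open>ran \<delta>\<close>.\<close>

type_synonym 'a representation = "baire \<rightharpoonup> 'a"

definition join :: "baire \<Rightarrow> baire \<Rightarrow> baire" (infixr \<open>\<oplus>\<close> 65) where
  "(p \<oplus> q) n = (if even n then p (n div 2) else q (n div 2))"

definition rep_baire :: "baire representation" where
  "rep_baire p = Some p"

definition rep_set :: "nat set representation" where
  "rep_set p = (if range p \<subseteq> {0, 1} then Some {n. p n = 1} else None)"

definition rep_linear_order :: "nat rel representation" where
  "rep_linear_order p =
     Option.bind (rep_set p)
       (\<lambda>S. let L = {(a, b). prod_encode (a, b) \<in> S} in if Linear_order L then Some L else None)"

text \<open>
  Partial functions with an explicitly given domain; for a fixed decidable domain this is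
  computably equivalent to naming the function by the characteristic function of its graph.
\<close>

definition rep_map :: "(nat \<rightharpoonup> nat) representation" where
  "rep_map p = Some (\<lambda>n. case p n of 0 \<Rightarrow> None | Suc m \<Rightarrow> Some m)"

text \<open>A family \<open>X\<close> is named by the set of all \<open>\<langle>a, x\<rangle>\<close> with \<open>x \<in> X a\<close>.\<close>

definition rep_family :: "(nat \<Rightarrow> nat set) representation" where
  "rep_family p = map_option (\<lambda>S a. {x. prod_encode (a, x) \<in> S}) (rep_set p)"

definition rep_prod :: "'a representation \<Rightarrow> 'b representation \<Rightarrow> ('a \<times> 'b) representation" where
  "rep_prod \<delta> \<epsilon> p =
     Option.bind (\<delta> (\<lambda>n. p (2 * n)))
       (\<lambda>x. Option.bind (\<epsilon> (\<lambda>n. p (2 * n + 1))) (\<lambda>y. Some (x, y)))"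

text \<open>
  The first entry of a name of an element of a disjoint sum indicates the summand.
\<close>

definition rep_sum :: "'a representation \<Rightarrow> 'b representation \<Rightarrow> ('a + 'b) representation" where
  "rep_sum \<delta> \<epsilon> p =
     (if p 0 = 0 then map_option Inl (\<delta> (\<lambda>n. p (Suc n)))
      else if p 0 = 1 then map_option Inr (\<epsilon> (\<lambda>n. p (Suc n)))
      else None)"


section \<open>Problems and Weihrauch reducibility\<close>

text \<open>
  A problem is a partial multivalued function between the spaces \<open>ran (inst_rep P)\<close> and
  \<open>ran (sol_rep P)\<close>. Its domain, the set of instances, consists of the points that have at least
  one solution.
\<close>

datatype ('a, 'b) problem =
  Problem (inst_rep: "'a representation") (sol_rep: "'b representation")
    (solutions: "'a \<Rightarrow> 'b set")

definition names_instance :: "('a, 'b) problem \<Rightarrow> baire \<Rightarrow> bool" where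
  "names_instance P p \<longleftrightarrow>
     (\<exists>x. inst_rep P p = Some x \<and> solutions P x \<inter> ran (sol_rep P) \<noteq> {})"

definition names_solution :: "('a, 'b) problem \<Rightarrow> baire \<Rightarrow> baire \<Rightarrow> bool" where
  "names_solution P p q \<longleftrightarrow>
     (\<exists>x y. inst_rep P p = Some x \<and> sol_rep P q = Some y \<and> y \<in> solutions P x)"

definition weihrauch_reducible :: "('a, 'b) problem \<Rightarrow> ('c, 'd) problem \<Rightarrow> bool"
    (infix \<open>\<le>\<^sub>W\<close> 50) where
  "P \<le>\<^sub>W Q \<longleftrightarrow>
     (\<exists>\<Phi> \<Psi>. computable \<Phi> \<and> computable \<Psi> \<and>
        (\<forall>p. names_instance P p \<longrightarrow>
           (\<exists>r. \<Phi> p = Some r \<and> names_instance Q r \<and>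
              (\<forall>q. names_solution Q r q \<longrightarrow>
                 (\<exists>s. \<Psi> (p \<oplus> q) = Some s \<and> names_solution P p s)))))"


section \<open>The problems\<close>

text \<open>
  A linear ordering on a subset of the natural numbers is a reflexive relation \<open>L\<close> with
  \<open>Linear_order L\<close>; the underlying subset is \<open>Field L\<close>, which may be finite or empty.
\<close>

definition descending_sequence :: "nat rel \<Rightarrow> (nat \<Rightarrow> nat) \<Rightarrow> bool" where
  "descending_sequence L s \<longleftrightarrow> (\<forall>i. (s (Suc i), s i) \<in> L \<and> s (Suc i) \<noteq> s i)"

definition initial_embedding :: "nat rel \<Rightarrow> nat rel \<Rightarrow> (nat \<rightharpoonup> nat) \<Rightarrow> bool" where
  "initial_embedding L M f \<longleftrightarrow>
     dom f = Field L \<and>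
     (\<forall>a\<in>Field L. \<forall>b\<in>Field L. (a, b) \<in> L \<longleftrightarrow> (the (f a), the (f b)) \<in> M) \<and>
     ofilter M (ran f)"

text \<open>
  The outer summand of a solution tells whether it is an embedding or a descending sequence, the
  inner summand tells which ordering is embedded or contains the sequence.
\<close>

definition CWO2 ::
    "(nat rel \<times> nat rel, ((nat \<rightharpoonup> nat) + (nat \<rightharpoonup> nat)) + ((nat \<Rightarrow> nat) + (nat \<Rightarrow> nat))) problem" where
  "CWO2 = Problem
     (rep_prod rep_linear_order rep_linear_order)
     (rep_sum (rep_sum rep_map rep_map) (rep_sum rep_baire rep_baire))
     (\<lambda>(L, M).
        {Inl (Inl f) | f. initial_embedding L M f} \<union>
        {Inl (Inr f) | f. initial_embedding M L f} \<union>
        {Inr (Inl s) | s. descending_sequence L s} \<union>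
        {Inr (Inr s) | s. descending_sequence M s})"

definition join_below :: "nat rel \<Rightarrow> (nat \<Rightarrow> nat set) \<Rightarrow> nat \<Rightarrow> nat set" where
  "join_below L X b = {prod_encode (a, x) | a x. (a, b) \<in> L \<and> a \<noteq> b \<and> x \<in> X a}"

text \<open>
  A family indexed by \<open>Field L\<close> is extended by the empty set outside of \<open>Field L\<close>, so that its
  name is exactly the set of all \<open>\<langle>a, x\<rangle>\<close> with \<open>a \<in> Field L\<close> and \<open>x \<in> X a\<close>. An ordering without
  first element has no jump hierarchies.
\<close>

definition jump_hierarchy :: "nat rel \<Rightarrow> nat set \<Rightarrow> (nat \<Rightarrow> nat set) \<Rightarrow> bool" where
  "jump_hierarchy L A X \<longleftrightarrow>
     (\<forall>a. a \<notin> Field L \<longrightarrow> X a = {}) \<and>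
     (\<exists>z\<in>Field L. (\<forall>a\<in>Field L. (z, a) \<in> L) \<and> X z = A \<and>
        (\<forall>b\<in>Field L. b \<noteq> z \<longrightarrow> X b = turing_jump (join_below L X b)))"

definition ATR2 :: "(nat rel \<times> nat set, (nat \<Rightarrow> nat) + (nat \<Rightarrow> nat set)) problem" where
  "ATR2 = Problem
     (rep_prod rep_linear_order rep_set)
     (rep_sum rep_baire rep_family)
     (\<lambda>(L, A). {Inl s | s. descending_sequence L s} \<union> {Inr X | X. jump_hierarchy L A X})"

end

theory Submission
  imports Defs
begin

text \<open>
  Given \<open>L\<close> and \<open>M\<close>, map \<open>a \<in> L\<close> to the least element of \<open>M\<close> that is not the value of any
  \<open>b <\<^sub>L a\<close>. With the recursion theorem, a jump hierarchy on \<open>1 + L \<cdot> 2 + 2\<close> computes this partial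
  map, even when \<open>L\<close> is ill-founded. Its range is always an initial segment of \<open>M\<close>. If it is total,
  it embeds \<open>L\<close> into \<open>M\<close>. If it is undefined at some \<open>a\<close> before the values exhaust \<open>M\<close>, then the
  remaining part of \<open>M\<close> has no least element, and a search yields a descending sequence in \<open>M\<close>.
  Otherwise its inverse embeds \<open>M\<close> into \<open>L\<close>. The two final stages of the hierarchy decide which case
  holds. A descending sequence in \<open>1 + L \<cdot> 2 + 2\<close> instead yields one in \<open>L\<close>.
\<close>

section \<open>Total functionals computed by programs\<close>

text \<open>A single program serves every oracle in \<open>S\<close>. The set acts as a promise:
  searches have to terminate only for oracles in \<open>S\<close>.\<close>

definition recursive_on :: "baire set \<Rightarrow> (baire \<Rightarrow> nat \<Rightarrow> nat) \<Rightarrow> bool" where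
  "recursive_on S F \<longleftrightarrow> (\<exists>c. \<forall>p\<in>S. \<forall>x. run p c x = Some (F p x))"

definition decidable_on :: "baire set \<Rightarrow> (baire \<Rightarrow> nat \<Rightarrow> bool) \<Rightarrow> bool" where
  "decidable_on S P \<longleftrightarrow> recursive_on S (\<lambda>p x. if P p x then 1 else 0)"

abbreviation pi1 :: "nat \<Rightarrow> nat" where "pi1 x \<equiv> fst (prod_decode x)"
abbreviation pi2 :: "nat \<Rightarrow> nat" where "pi2 x \<equiv> snd (prod_decode x)"

fun const_prog :: "nat \<Rightarrow> prog" where
  "const_prog 0 = Zero"
| "const_prog (Suc n) = Comp Succ (const_prog n)"

lemma run_const_prog [simp]: "run p (const_prog n) x = Some n"
  by (induction n) auto

definition id_prog :: prog where
  "id_prog = Pair Fst Snd"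

lemma run_id_prog [simp]: "run p id_prog x = Some x"
  by (simp add: id_prog_def)

lemma recursive_on_const: "recursive_on S (\<lambda>p x. n)"
  unfolding recursive_on_def by (metis run_const_prog)

lemma recursive_on_id: "recursive_on S (\<lambda>p x. x)"
  unfolding recursive_on_def by (metis run_id_prog)

lemma recursive_on_comp:
  assumes "recursive_on S G" "recursive_on S F"
  shows "recursive_on S (\<lambda>p x. G p (F p x))"
proof -
  obtain c d where "\<forall>p\<in>S. \<forall>x. run p c x = Some (G p x)" "\<forall>p\<in>S. \<forall>x. run p d x = Some (F p x)"
    using assms unfolding recursive_on_def by blast
  then have "\<forall>p\<in>S. \<forall>x. run p (Comp c d) x = Some (G p (F p x))" by simp
  then show ?thesis unfolding recursive_on_def by blast
qed

lemma recursive_on_oracle: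
  assumes "recursive_on S F" shows "recursive_on S (\<lambda>p x. p (F p x))"
  using recursive_on_comp[OF _ assms, of "\<lambda>p x. p x"] unfolding recursive_on_def
  by (metis run.simps(5))

lemma recursive_on_Suc:
  assumes "recursive_on S F" shows "recursive_on S (\<lambda>p x. Suc (F p x))"
  using recursive_on_comp[OF _ assms, of "\<lambda>p x. Suc x"] unfolding recursive_on_def
  by (metis run.simps(2))

lemma recursive_on_pi1:
  assumes "recursive_on S F" shows "recursive_on S (\<lambda>p x. pi1 (F p x))"
  using recursive_on_comp[OF _ assms, of "\<lambda>p x. pi1 x"] unfolding recursive_on_def
  by (metis run.simps(3))

lemma recursive_on_pi2:
  assumes "recursive_on S F" shows "recursive_on S (\<lambda>p x. pi2 (F p x))"
  using recursive_on_comp[OF _ assms, of "\<lambda>p x. pi2 x"] unfolding recursive_on_def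
  by (metis run.simps(4))

lemma recursive_on_pair:
  assumes "recursive_on S F" "recursive_on S G"
  shows "recursive_on S (\<lambda>p x. prod_encode (F p x, G p x))"
proof -
  obtain c d where "\<forall>p\<in>S. \<forall>x. run p c x = Some (F p x)" "\<forall>p\<in>S. \<forall>x. run p d x = Some (G p x)"
    using assms unfolding recursive_on_def by blast
  then have "\<forall>p\<in>S. \<forall>x. run p (Pair c d) x = Some (prod_encode (F p x, G p x))" by simp
  then show ?thesis unfolding recursive_on_def by blast
qed

text \<open>The hypothesis on \<open>G\<close> mirrors the input
  \<open>prod_encode (x, prod_encode (n, y))\<close> that \<open>PrimRec\<close> passes to its step
  program.\<close>

lemma recursive_on_rec_nat:
  assumes F: "recursive_on S F"
    and G: "recursive_on S (\<lambda>p z. G p (pi1 z) (pi1 (pi2 z)) (pi2 (pi2 z)))"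
    and H: "recursive_on S H"
  shows "recursive_on S (\<lambda>p x. rec_nat (F p x) (\<lambda>n r. G p x n r) (H p x))"
proof -
  obtain c d where c: "\<forall>p\<in>S. \<forall>x. run p c x = Some (F p x)"
    and d: "\<forall>p\<in>S. \<forall>z. run p d z = Some (G p (pi1 z) (pi1 (pi2 z)) (pi2 (pi2 z)))"
    using F G unfolding recursive_on_def by blast
  have "run p (PrimRec c d) (prod_encode (x, n)) = Some (rec_nat (F p x) (\<lambda>n r. G p x n r) n)"
    if "p \<in> S" for p x n
    by (induction n) (use c d that in auto)
  then have "recursive_on S (\<lambda>p z. rec_nat (F p (pi1 z)) (\<lambda>n r. G p (pi1 z) n r) (pi2 z))"
    unfolding recursive_on_def by (metis prod_decode_inverse prod.collapse)
  from recursive_on_comp[OF this recursive_on_pair[OF recursive_on_id H]]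
  show ?thesis by simp
qed

lemma recursive_on_if:
  assumes "decidable_on S P" "recursive_on S F" "recursive_on S G"
  shows "recursive_on S (\<lambda>p x. if P p x then F p x else G p x)"
proof -
  have "recursive_on S (\<lambda>p x. rec_nat (G p x) (\<lambda>n r. F p x) (if P p x then 1 else 0))"
    by (intro recursive_on_rec_nat assms(3) assms(1)[unfolded decidable_on_def]
        recursive_on_comp[OF assms(2)] recursive_on_pi1 recursive_on_id)
  moreover have "rec_nat (G p x) (\<lambda>n r. F p x) (if P p x then 1 else 0)
      = (if P p x then F p x else G p x)" for p x
    by simp
  ultimately show ?thesis by simp
qed

lemma recursive_on_add:
  assumes "recursive_on S F" "recursive_on S G"
  shows "recursive_on S (\<lambda>p x. F p x + G p x)"
proof -
  have "recursive_on S (\<lambda>p x. rec_nat (F p x) (\<lambda>n r. Suc r) (G p x))"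
    by (intro recursive_on_rec_nat assms recursive_on_Suc recursive_on_pi2 recursive_on_id)
  moreover have "rec_nat m (\<lambda>n r. Suc r) n = m + n" for m n
    by (induction n) auto
  ultimately show ?thesis by simp
qed

lemma recursive_on_diff:
  assumes "recursive_on S F" "recursive_on S G"
  shows "recursive_on S (\<lambda>p x. F p x - G p x)"
proof -
  \<comment> \<open>Predecessor, as a recursion that discards the previous value.\<close>
  have "recursive_on S (\<lambda>p x. rec_nat 0 (\<lambda>n r. n) x)"
    by (intro recursive_on_rec_nat recursive_on_pi1 recursive_on_pi2 recursive_on_id recursive_on_const)
  moreover have "rec_nat 0 (\<lambda>n r. n) m = m - 1" for m :: nat
    by (cases m) auto
  ultimately have "recursive_on S (\<lambda>p x. x - 1)" by simp
  then have "recursive_on S (\<lambda>p x. rec_nat (F p x) (\<lambda>n r. r - 1) (G p x))"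
    by (intro recursive_on_rec_nat assms)
      (rule recursive_on_comp, assumption, intro recursive_on_pi2 recursive_on_id)
  moreover have "rec_nat m (\<lambda>n r. r - 1) n = m - n" for m n :: nat
    by (induction n) auto
  ultimately show ?thesis by simp
qed

lemma decidable_on_eq:
  assumes "recursive_on S F" "recursive_on S G"
  shows "decidable_on S (\<lambda>p x. F p x = G p x)"
proof -
  have "recursive_on S (\<lambda>p x. 1 - ((F p x - G p x) + (G p x - F p x)))"
    by (intro recursive_on_diff recursive_on_add assms recursive_on_const)
  moreover have "1 - ((m - n) + (n - m)) = (if m = n then 1 else 0)" for m n :: nat
    by auto
  ultimately show ?thesis by (simp add: decidable_on_def)
qed

lemma decidable_on_le:
  assumes "recursive_on S F" "recursive_on S G"
  shows "decidable_on S (\<lambda>p x. F p x \<le> G p x)"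
proof -
  have "recursive_on S (\<lambda>p x. 1 - (F p x - G p x))"
    by (intro recursive_on_diff assms recursive_on_const)
  moreover have "1 - (m - n) = (if m \<le> n then 1 else 0)" for m n :: nat
    by auto
  ultimately show ?thesis by (simp add: decidable_on_def)
qed

lemma decidable_on_not:
  assumes "decidable_on S P" shows "decidable_on S (\<lambda>p x. \<not> P p x)"
proof -
  have "recursive_on S (\<lambda>p x. if P p x then 0 else 1)"
    by (intro recursive_on_if assms recursive_on_const)
  moreover have "(if P p x then 0 else 1) = (if \<not> P p x then 1 else (0::nat))" for p x
    by simp
  ultimately show ?thesis by (simp only: decidable_on_def)
qed

lemma decidable_on_and:
  assumes "decidable_on S P" "decidable_on S Q"
  shows "decidable_on S (\<lambda>p x. P p x \<and> Q p x)"
proof -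
  have "recursive_on S (\<lambda>p x. if P p x then (if Q p x then 1 else 0) else 0)"
    by (intro recursive_on_if assms recursive_on_const)
  moreover have "(if a then (if b then 1 else 0) else 0) = (if a \<and> b then 1 else (0::nat))" for a b
    by simp
  ultimately show ?thesis by (simp add: decidable_on_def)
qed

lemma decidable_on_or:
  assumes "decidable_on S P" "decidable_on S Q"
  shows "decidable_on S (\<lambda>p x. P p x \<or> Q p x)"
  using decidable_on_not[OF decidable_on_and[OF assms[THEN decidable_on_not]]] by simp

lemma decidable_on_if:
  assumes "decidable_on S P" "decidable_on S Q" "decidable_on S R"
  shows "decidable_on S (\<lambda>p x. if P p x then Q p x else R p x)"
proof -
  have "recursive_on S (\<lambda>p x. if P p x then (if Q p x then 1 else 0) else (if R p x then 1 else 0))"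
    by (intro recursive_on_if assms assms[unfolded decidable_on_def])
  moreover have "(if a then (if b then 1 else 0) else (if c then 1 else 0))
      = (if (if a then b else c) then 1 else (0::nat))" for a b c
    by simp
  ultimately show ?thesis by (simp add: decidable_on_def)
qed

section \<open>Unbounded search\<close>

lemma run_Mu_if_total:
  assumes "\<And>n. run p c (prod_encode (x, n)) = Some (if P n then 0 else 1)"
  shows "run p (Mu c) x = (if \<exists>n. P n then Some (LEAST n. P n) else None)"
proof (cases "\<exists>n. P n")
  case True
  have "run p c (prod_encode (x, LEAST n. P n)) = Some 0"
    using LeastI_ex[OF True] assms by simp
  moreover have "\<forall>m < (LEAST n. P n). \<exists>k. run p c (prod_encode (x, m)) = Some (Suc k)"
    using assms by (auto dest: not_less_Least)
  ultimately have "\<exists>n. run p c (prod_encode (x, n)) = Some 0 \<and>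
      (\<forall>m<n. \<exists>k. run p c (prod_encode (x, m)) = Some (Suc k))"
    by blast
  then have "run p (Mu c) x = Some (LEAST n. run p c (prod_encode (x, n)) = Some 0)"
    by (simp only: run.simps if_True)
  also have "(LEAST n. run p c (prod_encode (x, n)) = Some 0) = (LEAST n. P n)"
    by (simp add: assms)
  finally show ?thesis using True by simp
next
  case False
  then show ?thesis using assms by simp
qed

text \<open>\<open>LEAST\<close> always denotes a number, but the search for it halts only where a
  witness exists; hence \<open>total\<close>.\<close>

lemma recursive_on_Least:
  assumes P: "decidable_on S (\<lambda>p z. P p (pi1 z) (pi2 z))"
    and total: "\<And>p x. p \<in> S \<Longrightarrow> \<exists>n. P p x n"
  shows "recursive_on S (\<lambda>p x. LEAST n. P p x n)"
proof -
  have "recursive_on S (\<lambda>p z. if P p (pi1 z) (pi2 z) then 0 else 1)"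
    by (intro recursive_on_if assms recursive_on_const)
  then obtain c where c: "\<forall>p\<in>S. \<forall>z. run p c z = Some (if P p (pi1 z) (pi2 z) then 0 else 1)"
    unfolding recursive_on_def by blast
  have "run p (Mu c) x = Some (LEAST n. P p x n)" if "p \<in> S" for p x
    using run_Mu_if_total[of p c x "P p x"] c that total by simp
  then show ?thesis unfolding recursive_on_def by blast
qed

lemma semidecidable:
  assumes P: "decidable_on UNIV (\<lambda>p z. P p (pi1 z) (pi2 z))"
  obtains c where "\<And>p x. run p c x \<noteq> None \<longleftrightarrow> (\<exists>n. P p x n)"
proof -
  have "recursive_on UNIV (\<lambda>p z. if P p (pi1 z) (pi2 z) then 0 else 1)"
    by (intro recursive_on_if assms recursive_on_const)
  then obtain c where c: "\<forall>p z. run p c z = Some (if P p (pi1 z) (pi2 z) then 0 else 1)"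
    unfolding recursive_on_def by blast
  have "run p (Mu c) x \<noteq> None \<longleftrightarrow> (\<exists>n. P p x n)" for p x
    using run_Mu_if_total[of p c x "P p x"] c by (auto simp del: run.simps)
  then show ?thesis using that by blast
qed

text \<open>Unlike in \<open>recursive_on_if\<close>, only the selected branch is evaluated.\<close>

lemma recursive_on_branch:
  assumes b: "decidable_on S (\<lambda>p x. b p)"
    and F: "recursive_on {p \<in> S. b p} F" and G: "recursive_on {p \<in> S. \<not> b p} G"
  shows "recursive_on S (\<lambda>p. if b p then F p else G p)"
proof -
  obtain f g where f: "\<And>p x. p \<in> S \<Longrightarrow> b p \<Longrightarrow> run p f x = Some (F p x)"
    and g: "\<And>p x. p \<in> S \<Longrightarrow> \<not> b p \<Longrightarrow> run p g x = Some (G p x)"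
    using F G unfolding recursive_on_def by blast
  obtain t where t: "\<And>p x. p \<in> S \<Longrightarrow> run p t x = Some (if b p then 1 else 0)"
    using b unfolding decidable_on_def recursive_on_def by blast
  obtain t' where t': "\<And>p x. p \<in> S \<Longrightarrow> run p t' x = Some (if \<not> b p then 1 else 0)"
    using decidable_on_not[OF b] unfolding decidable_on_def recursive_on_def by blast
  obtain a where a: "\<And>p x. run p a x = Some (pi1 x + pi2 x)"
    using recursive_on_add[OF recursive_on_pi1[OF recursive_on_id] recursive_on_pi2[OF recursive_on_id],
        of UNIV] unfolding recursive_on_def by auto
  \<comment> \<open>The test \<open>u\<close> supplies the number of recursion steps, so
    \<open>h\<close> runs only if the test returns 1; otherwise the value is 0. Adding both lazy
    branches therefore gives the selected one.\<close>
  define lazy where "lazy h u = Comp (PrimRec Zero (Comp h Fst)) (Pair id_prog u)" for h u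
  have "run p (Comp a (Pair (lazy f t) (lazy g t'))) x = Some ((if b p then F p else G p) x)"
    if "p \<in> S" for p x
    by (simp add: lazy_def t[OF that] t'[OF that] a f[OF that] g[OF that])
  then show ?thesis unfolding recursive_on_def by blast
qed

section \<open>Arithmetic for joined names\<close>

lemma recursive_on_parity:
  assumes "recursive_on S F" shows "recursive_on S (\<lambda>p x. F p x mod 2)"
proof -
  have "recursive_on S (\<lambda>p x. rec_nat 0 (\<lambda>n r. 1 - r) x)"
    by (intro recursive_on_rec_nat recursive_on_diff recursive_on_pi2 recursive_on_id recursive_on_const)
  moreover have "rec_nat 0 (\<lambda>n r. 1 - r) m = m mod 2" for m :: nat
    by (induction m) (auto simp: mod_Suc)
  ultimately show ?thesis using recursive_on_comp[OF _ assms] by auto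
qed

lemma recursive_on_half:
  assumes "recursive_on S F" shows "recursive_on S (\<lambda>p x. F p x div 2)"
proof -
  have "recursive_on S (\<lambda>p x. rec_nat 0 (\<lambda>n r. r + n mod 2) x)"
    by (intro recursive_on_rec_nat recursive_on_add recursive_on_parity recursive_on_pi1
        recursive_on_pi2 recursive_on_id recursive_on_const)
  moreover have "rec_nat 0 (\<lambda>n r. r + n mod 2) m = m div 2" for m :: nat
    by (induction m) (simp, simp, presburger)
  ultimately show ?thesis using recursive_on_comp[OF _ assms] by auto
qed

lemma recursive_on_double:
  assumes "recursive_on S F" shows "recursive_on S (\<lambda>p x. 2 * F p x)"
  unfolding mult_2 by (intro recursive_on_add assms)

lemmas recursive_intros =
  recursive_on_double recursive_on_const recursive_on_id recursive_on_oracle recursive_on_Suc recursive_on_pi1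
  recursive_on_pi2 recursive_on_pair recursive_on_if recursive_on_add recursive_on_diff
  decidable_on_eq decidable_on_le decidable_on_not decidable_on_and decidable_on_or
  decidable_on_if recursive_on_half recursive_on_parity

lemma computable_if_recursive_on:
  assumes "recursive_on S F"
  shows "computable (\<lambda>p. if p \<in> S then Some (F p) else None)"
  using assms unfolding recursive_on_def computable_def by auto

section \<open>The recursion theorem and the Turing jump\<close>

definition const_code :: "nat \<Rightarrow> nat" where
  "const_code n = code (const_prog n)"

text \<open>An s-m-n function; 6 is the tag of \<open>Comp\<close>. The program with code
  \<open>index (code e) n\<close> ignores its input, so the diagonal question asked by the jump
  becomes whether \<open>e\<close> halts at \<open>n\<close>.\<close>

definition index :: "nat \<Rightarrow> nat \<Rightarrow> nat" where
  "index k n = prod_encode (6, prod_encode (k, const_code n))"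

lemma index_code: "index (code e) n = code (Comp e (const_prog n))"
  by (simp add: index_def const_code_def)

lemma recursive_on_const_code:
  assumes "recursive_on S F" shows "recursive_on S (\<lambda>p x. const_code (F p x))"
proof -
  have "recursive_on S (\<lambda>p x. rec_nat (code Zero)
      (\<lambda>n r. prod_encode (6, prod_encode (code Succ, r))) x)"
    by (intro recursive_on_rec_nat recursive_intros)
  moreover have "rec_nat (code Zero) (\<lambda>n r. prod_encode (6, prod_encode (code Succ, r))) n
      = const_code n" for n
    by (induction n) (simp_all add: const_code_def)
  ultimately show ?thesis using recursive_on_comp[OF _ assms] by auto
qed

lemma recursive_on_index:
  assumes "recursive_on S F" "recursive_on S G"
  shows "recursive_on S (\<lambda>p x. index (F p x) (G p x))"
  unfolding index_def by (intro recursive_intros recursive_on_const_code assms)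

text \<open>Kleene's diagonal construction. The program \<open>e\<close> is independent of the
  oracle, so one \<open>e\<close> works at all stages of a hierarchy.\<close>

lemma recursion_theorem:
  obtains e where "\<And>p x. run p e x = run p c (prod_encode (code e, x))"
proof -
  \<comment> \<open>\<open>s k\<close> codes the program that runs program \<open>k\<close> on the
    pair of \<open>k\<close> and the input; 6 and 5 are the tags of \<open>Comp\<close> and
    \<open>Pair\<close>.\<close>
  define s where "s k = prod_encode (6, prod_encode (k, prod_encode (5,
      prod_encode (const_code k, code id_prog))))" for k
  have "recursive_on UNIV (\<lambda>p z. prod_encode (s (pi1 z), pi2 z))"
    unfolding s_def by (intro recursive_intros recursive_on_const_code)
  then obtain g where g: "\<And>p z. run p g z = Some (prod_encode (s (pi1 z), pi2 z))"
    unfolding recursive_on_def by blast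
  \<comment> \<open>\<open>d\<close> replaces \<open>k\<close> by \<open>s k\<close> and calls
    \<open>c\<close>. Fed with its own code, it passes on \<open>s (code d)\<close>, the code of
    \<open>e\<close>.\<close>
  define d where "d = Comp c g"
  define e where "e = Comp d (Pair (const_prog (code d)) id_prog)"
  have "code e = s (code d)"
    by (simp add: e_def s_def const_code_def)
  then have "run p e x = run p c (prod_encode (code e, x))" for p x
    by (simp add: e_def d_def g)
  then show ?thesis using that by blast
qed

text \<open>
  Since \<open>P\<close> receives the code \<open>code e\<close>, it may ask whether \<open>index (code e) m\<close> belongs to the jumps
  encoded in its oracle; along a jump hierarchy this is a recursive definition with \<open>\<Sigma>\<^sub>1\<close>
  clauses, valid without any appeal to well-foundedness.
\<close>

lemma jump_recursion:
  assumes "decidable_on UNIV (\<lambda>p z. P p (pi1 (pi1 z)) (pi2 (pi1 z)) (pi2 z))"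
  obtains e where "\<And>Y n. index (code e) n \<in> turing_jump Y \<longleftrightarrow> (\<exists>w. P (char_fun Y) (code e) n w)"
proof -
  obtain c where c: "\<And>p x. run p c x \<noteq> None \<longleftrightarrow> (\<exists>w. P p (pi1 x) (pi2 x) w)"
    using semidecidable[of "\<lambda>p x w. P p (pi1 x) (pi2 x) w"] assms by blast
  obtain e where e: "\<And>p x. run p e x = run p c (prod_encode (code e, x))"
    using recursion_theorem by blast
  have "index (code e) n \<in> turing_jump Y \<longleftrightarrow> (\<exists>w. P (char_fun Y) (code e) n w)" for Y n
  proof -
    have "index (code e) n \<in> turing_jump Y \<longleftrightarrow> run (char_fun Y) e n \<noteq> None"
      unfolding turing_jump_def index_code by (auto simp: code_inject simp del: code.simps)
    also have "\<dots> \<longleftrightarrow> (\<exists>w. P (char_fun Y) (code e) n w)"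
      unfolding e c by simp
    finally show ?thesis .
  qed
  then show ?thesis using that by blast
qed

section \<open>Comparing linear orderings\<close>

text \<open>
  \<open>G a\<close> is the graph of the map sending \<open>a\<close> to the least element of \<open>M\<close> outside \<open>U a\<close>, the set of
  all earlier values. Neither ordering is assumed to be well-founded.
\<close>

lemma ran_eq_image: "ran f = (\<lambda>a. the (f a)) ` dom f"
  by (force simp: ran_def dom_def image_iff)

locale comparison =
  fixes L M :: "nat rel" and U G :: "nat \<Rightarrow> nat \<Rightarrow> bool"
  assumes L: "Linear_order L" and M: "Linear_order M"
    and U_iff: "a \<in> Field L \<Longrightarrow> U a c \<longleftrightarrow> (\<exists>b. (b, a) \<in> L \<and> b \<noteq> a \<and> G b c)"
    and G_iff: "a \<in> Field L \<Longrightarrow>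
      G a c \<longleftrightarrow> c \<in> Field M \<and> \<not> U a c \<and> (\<forall>d. (d, c) \<in> M \<and> d \<noteq> c \<longrightarrow> U a d)"
begin

lemma L_refl: "a \<in> Field L \<Longrightarrow> (a, a) \<in> L"
  and L_trans: "(a, b) \<in> L \<Longrightarrow> (b, c) \<in> L \<Longrightarrow> (a, c) \<in> L"
  and L_antisym: "(a, b) \<in> L \<Longrightarrow> (b, a) \<in> L \<Longrightarrow> a = b"
  and L_total: "a \<in> Field L \<Longrightarrow> b \<in> Field L \<Longrightarrow> a \<noteq> b \<Longrightarrow> (a, b) \<in> L \<or> (b, a) \<in> L"
  using L unfolding order_on_defs
  by (auto simp: refl_on_def total_on_def dest: transD antisymD)

lemma M_refl: "a \<in> Field M \<Longrightarrow> (a, a) \<in> M"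
  and M_antisym: "(a, b) \<in> M \<Longrightarrow> (b, a) \<in> M \<Longrightarrow> a = b"
  and M_total: "a \<in> Field M \<Longrightarrow> b \<in> Field M \<Longrightarrow> a \<noteq> b \<Longrightarrow> (a, b) \<in> M \<or> (b, a) \<in> M"
  using M unfolding order_on_defs
  by (auto simp: refl_on_def total_on_def dest: antisymD)

lemma G_unique:
  assumes "a \<in> Field L" "G a c" "G a d"
  shows "c = d"
  using assms G_iff M_total by metis

lemma G_less:
  assumes "(a, b) \<in> L" "a \<noteq> b" "G a c" "G b d"
  shows "(c, d) \<in> M \<and> c \<noteq> d"
proof -
  have ab: "a \<in> Field L" "b \<in> Field L" using assms(1) by (auto intro: FieldI1 FieldI2)
  have cd: "c \<in> Field M" "d \<in> Field M" "\<not> U b d" using assms ab G_iff by auto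
  have "c \<noteq> d" using U_iff[OF ab(2)] assms cd by blast
  moreover have "(d, c) \<notin> M"
  proof
    assume "(d, c) \<in> M"
    then have "U a d" using G_iff[OF ab(1)] assms(3) \<open>c \<noteq> d\<close> by blast
    then obtain b' where "(b', a) \<in> L" "b' \<noteq> a" "G b' d" using U_iff[OF ab(1)] by blast
    then have "U b d" using U_iff[OF ab(2)] L_trans L_antisym assms(1) by blast
    then show False using cd by blast
  qed
  ultimately show ?thesis using M_total cd by blast
qed

lemma G_inj:
  assumes "a \<in> Field L" "b \<in> Field L" "G a c" "G b c"
  shows "a = b"
  using G_less L_total assms by metis

lemma G_le_iff:
  assumes "a \<in> Field L" "b \<in> Field L" "G a c" "G b d"
  shows "(a, b) \<in> L \<longleftrightarrow> (c, d) \<in> M"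
proof (cases "a = b")
  case True
  then show ?thesis using assms G_unique G_iff L_refl M_refl by metis
next
  case False
  then show ?thesis using assms G_less L_total M_antisym by metis
qed

lemma G_initial:
  assumes "a \<in> Field L" "G a c" "(d, c) \<in> M"
  shows "\<exists>b\<in>Field L. G b d"
  using assms G_iff[OF assms(1)] U_iff[OF assms(1)] by (metis FieldI1)

lemma not_least:
  assumes "a \<in> Field L" "\<nexists>c. G a c" "c \<in> Field M" "\<not> U a c"
  shows "\<exists>d. (d, c) \<in> M \<and> d \<noteq> c \<and> \<not> U a d"
  using assms G_iff by blast

lemma initial_embedding_LM:
  assumes f: "dom f = Field L" "\<And>a. a \<in> Field L \<Longrightarrow> G a (the (f a))"
  shows "initial_embedding L M f"
  unfolding initial_embedding_def
proof (intro conjI ballI)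
  have ran: "c \<in> ran f \<longleftrightarrow> (\<exists>a\<in>Field L. c = the (f a))" for c
    by (simp only: f(1)[symmetric] ran_eq_image image_iff)
  show "ofilter M (ran f)"
    unfolding ofilter_def
  proof (intro conjI ballI subsetI)
    fix c assume "c \<in> ran f"
    then obtain a where "a \<in> Field L" "c = the (f a)" unfolding ran by blast
    then have a: "a \<in> Field L" "G a c" using f(2) by simp_all
    then show "c \<in> Field M" using G_iff by blast
    fix d assume "d \<in> under M c"
    then obtain b where "b \<in> Field L" "G b d"
      using G_initial[OF a] by (auto simp: under_def)
    then have "b \<in> Field L" "d = the (f b)" using f(2) G_unique by metis+
    then show "d \<in> ran f" unfolding ran by blast
  qed
qed (use f G_le_iff in auto)

text \<open>Here \<open>f\<close> inverts the comparison map. By \<open>onto\<close>, that map is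
  undefined only where \<open>M\<close> is already exhausted.\<close>

lemma initial_embedding_ML:
  assumes onto: "\<And>a c. a \<in> Field L \<Longrightarrow> \<nexists>c. G a c \<Longrightarrow> c \<in> Field M \<Longrightarrow> U a c"
    and f: "dom f = Field M" "\<And>c. c \<in> Field M \<Longrightarrow> the (f c) \<in> Field L \<and> G (the (f c)) c"
  shows "initial_embedding M L f"
  unfolding initial_embedding_def
proof (intro conjI ballI)
  have ran: "a \<in> ran f \<longleftrightarrow> (\<exists>c\<in>Field M. a = the (f c))" for a
    by (simp only: f(1)[symmetric] ran_eq_image image_iff)
  show "ofilter L (ran f)"
    unfolding ofilter_def
  proof (intro conjI ballI subsetI)
    fix a assume "a \<in> ran f"
    then obtain c where "c \<in> Field M" "a = the (f c)" unfolding ran by blast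
    then have c: "c \<in> Field M" "a \<in> Field L" "G a c" using f(2) by simp_all
    then show "a \<in> Field L" by blast
    fix b assume "b \<in> under L a"
    then have ba: "(b, a) \<in> L" "b \<in> Field L" by (auto simp: under_def intro: FieldI1)
    have "\<exists>d. G b d"
    proof (rule ccontr)
      assume "\<nexists>d. G b d"
      then have "U b c" "b \<noteq> a" using onto c ba by blast+
      then have "U a c"
        using U_iff[OF ba(2)] U_iff[OF c(2)] ba(1) L_trans L_antisym by metis
      then show False using G_iff c by blast
    qed
    then obtain d where d: "G b d" "d \<in> Field M" using G_iff ba by blast
    then have "b = the (f d)" using f(2)[OF d(2)] G_inj ba by metis
    then show "b \<in> ran f" unfolding ran using d by blast
  qed
  fix c d assume "c \<in> Field M" "d \<in> Field M"
  then show "(c, d) \<in> M \<longleftrightarrow> (the (f c), the (f d)) \<in> L" using f(2) G_le_iff by metis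
qed (use f in simp)

end

section \<open>The ordering of the stages\<close>

text \<open>
  The ordering \<open>1 + L \<cdot> 2 + 2\<close>. Stage \<open>\<langle>1, a\<rangle>\<close> is devoted to \<open>U a\<close>, stage \<open>\<langle>2, a\<rangle>\<close> to
  the complement of \<open>G a\<close>, and the stages \<open>\<langle>3, 0\<rangle>\<close> and \<open>\<langle>4, 0\<rangle>\<close> decide which kind of solution
  there is.
\<close>

definition stage :: "nat rel \<Rightarrow> nat \<Rightarrow> bool" where
  "stage L x \<longleftrightarrow>
     (if pi1 x = 1 \<or> pi1 x = 2 then (pi2 x, pi2 x) \<in> L else pi1 x \<le> 4 \<and> pi2 x = 0)"

definition stage_less_eq :: "nat rel \<Rightarrow> nat \<Rightarrow> nat \<Rightarrow> bool" where
  "stage_less_eq L x y \<longleftrightarrow> stage L x \<and> stage L y \<and>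
     (if (pi1 x = 1 \<or> pi1 x = 2) \<and> (pi1 y = 1 \<or> pi1 y = 2)
      then if pi2 x = pi2 y then pi1 x \<le> pi1 y else (pi2 x, pi2 y) \<in> L
      else pi1 x \<le> pi1 y)"

definition stages :: "nat rel \<Rightarrow> nat rel" where
  "stages L = {(x, y). stage_less_eq L x y}"

lemma Field_stages: "Field (stages L) = {x. stage L x}"
  by (auto simp: Field_def stages_def stage_less_eq_def split: if_splits)

lemma pi_eqI: "pi1 x = pi1 y \<Longrightarrow> pi2 x = pi2 y \<Longrightarrow> x = y"
  by (metis prod.expand prod_decode_inverse)

lemma Linear_order_stages:
  assumes "Linear_order L"
  shows "Linear_order (stages L)"
proof -
  have L: "trans L" "antisym L" "\<And>a b. (a, a) \<in> L \<Longrightarrow> (b, b) \<in> L \<Longrightarrow> a \<noteq> b \<Longrightarrow> (a, b) \<in> L \<or> (b, a) \<in> L"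
    using assms unfolding order_on_defs by (auto simp: total_on_def dest: FieldI1)
  have "refl_on (Field (stages L)) (stages L)"
    unfolding refl_on_def Field_stages by (auto simp: stages_def stage_less_eq_def)
  moreover have "stages L \<subseteq> Field (stages L) \<times> Field (stages L)"
    unfolding Field_stages by (auto simp: stages_def stage_less_eq_def)
  moreover have "trans (stages L)"
  proof (rule transI)
    fix x y z assume xyz: "(x, y) \<in> stages L" "(y, z) \<in> stages L"
    let ?inner = "\<lambda>x. pi1 x = 1 \<or> pi1 x = 2"
    have st: "stage L x" "stage L y" "stage L z"
      using xyz by (auto simp: stages_def stage_less_eq_def)
    show "(x, z) \<in> stages L"
    proof (cases "?inner x \<and> ?inner y \<and> ?inner z")
      case True
      then show ?thesis
        using xyz st transD[OF L(1), of "pi2 x" "pi2 y" "pi2 z"] antisymD[OF L(2), of "pi2 x" "pi2 y"]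
        by (auto simp: stages_def stage_less_eq_def split: if_splits)
    next
      case False
      \<comment> \<open>Rows 1 and 2 together are convex: if \<open>x\<close> and \<open>z\<close>
        lie in them, so does \<open>y\<close>. In this case the rows alone decide.\<close>
      then have "pi1 x \<le> pi1 z" "\<not> (?inner x \<and> ?inner z)"
        using xyz by (auto simp: stages_def stage_less_eq_def simp del: One_nat_def split: if_splits)
      then show ?thesis using st unfolding stages_def stage_less_eq_def by auto
    qed
  qed
  moreover have "antisym (stages L)"
  proof (rule antisymI)
    fix x y assume xy: "(x, y) \<in> stages L" "(y, x) \<in> stages L"
    let ?inner = "\<lambda>x. pi1 x = 1 \<or> pi1 x = 2"
    show "x = y"
    proof (cases "?inner x \<and> ?inner y")
      case True
      then have "pi2 x = pi2 y"
        using xy antisymD[OF L(2), of "pi2 x" "pi2 y"]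
        by (auto simp: stages_def stage_less_eq_def split: if_splits)
      with True xy have "pi1 x = pi1 y"
        by (auto simp: stages_def stage_less_eq_def)
      then show ?thesis using \<open>pi2 x = pi2 y\<close> by (rule pi_eqI)
    next
      case False
      then have "pi1 x \<le> pi1 y" "pi1 y \<le> pi1 x" "stage L x" "stage L y"
        using xy unfolding stages_def stage_less_eq_def by auto
      then have "pi1 x = pi1 y" "\<not> ?inner x" "\<not> ?inner y" using False by auto
      moreover from this have "pi2 x = pi2 y"
        using \<open>stage L x\<close> \<open>stage L y\<close> by (simp add: stage_def)
      ultimately show ?thesis by (simp add: pi_eqI)
    qed
  qed
  moreover have "total_on (Field (stages L)) (stages L)"
  proof (rule total_onI)
    fix x y assume "x \<in> Field (stages L)" "y \<in> Field (stages L)" "x \<noteq> y"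
    then have st: "stage L x" "stage L y" by (simp_all add: Field_stages)
    let ?inner = "\<lambda>x. pi1 x = 1 \<or> pi1 x = 2"
    show "(x, y) \<in> stages L \<or> (y, x) \<in> stages L"
    proof (cases "?inner x \<and> ?inner y")
      case True
      then have "(pi2 x, pi2 x) \<in> L" "(pi2 y, pi2 y) \<in> L" using st by (simp_all add: stage_def)
      then show ?thesis
        using True st L(3)[of "pi2 x" "pi2 y"] nat_le_linear[of "pi1 x" "pi1 y"]
        unfolding stages_def stage_less_eq_def by (cases "pi2 x = pi2 y") simp_all
    next
      case False
      then show ?thesis
        using st nat_le_linear[of "pi1 x" "pi1 y"] unfolding stages_def stage_less_eq_def by auto
    qed
  qed
  ultimately show ?thesis unfolding order_on_defs by blast
qed

text \<open>The bottom stage exists even for empty \<open>L\<close>, so the hierarchy always has a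
  place for its starting set.\<close>

lemma stages_least: "stage L x \<Longrightarrow> (prod_encode (0, 0), x) \<in> stages L"
  by (auto simp: stages_def stage_less_eq_def stage_def)

text \<open>At most two entries lie in rows 4 and 3, and row 0 has nothing below it, so the sequence
  stays in rows 1 and 2 from index 2 on. Each element of \<open>L\<close> occupies at most two
  consecutive entries there; taking every second entry makes the descent strict.\<close>

lemma descending_sequence_stages:
  assumes L: "Linear_order L" and s: "descending_sequence (stages L) s"
  shows "descending_sequence L (\<lambda>i. pi2 (s (2 * i + 2)))"
proof -
  define k where "k i = pi1 (s i)" for i
  define a where "a i = pi2 (s i)" for i
  have step: "stage_less_eq L (s (Suc i)) (s i)" "s (Suc i) \<noteq> s i" for i
    using s by (auto simp: descending_sequence_def stages_def)
  \<comment> \<open>A row other than 1 and 2 has a single stage, so a strict step touching it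
    changes the row.\<close>
  have drop: "k (Suc i) < k i" if "\<not> (k (Suc i) \<in> {1, 2} \<and> k i \<in> {1, 2})" for i
    using step[of i] that pi_eqI[of "s (Suc i)" "s i"]
    by (force simp: stage_less_eq_def stage_def k_def split: if_splits)
  have mono: "k (Suc i) \<le> k i \<or> (k (Suc i) \<in> {1, 2} \<and> k i \<in> {1, 2})" for i
    using drop[of i] by linarith
  have "k 0 \<le> 4" using step(1)[of 0] by (auto simp: stage_less_eq_def stage_def k_def split: if_splits)
  then have "k 2 \<le> 2"
    using drop[of 0] drop[of 1] mono[of 1] by (cases "k 1 \<le> 2") (auto simp: numeral_2_eq_2)
  have le2: "k (i + 2) \<le> 2" for i
  proof (induction i)
    case (Suc i)
    then show ?case using mono[of "i + 2"] by auto
  qed (use \<open>k 2 \<le> 2\<close> in \<open>simp add: numeral_2_eq_2\<close>)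
  have pos: "k i \<noteq> 0" for i
    using drop[of i] by fastforce
  have k: "k (i + 2) = 1 \<or> k (i + 2) = 2" for i
    using le2[of i] pos[of "i + 2"] by linarith
  have a_step: "(if a (Suc (i + 2)) = a (i + 2) then k (Suc (i + 2)) < k (i + 2)
      else (a (Suc (i + 2)), a (i + 2)) \<in> L)" "(a (i + 2), a (i + 2)) \<in> L" for i
    using step[of "i + 2"] k[of i] k[of "Suc i"] pi_eqI[of "s (Suc (i + 2))" "s (i + 2)"]
    by (auto simp: stage_less_eq_def stage_def k_def a_def split: if_splits)
  have "trans L" "antisym L"
    using L unfolding order_on_defs by blast+
  \<comment> \<open>A step that keeps \<open>a\<close> goes from row 2 to row 1, which cannot happen
    twice in succession.\<close>
  then have "(a (Suc (Suc (i + 2))), a (i + 2)) \<in> L \<and> a (Suc (Suc (i + 2))) \<noteq> a (i + 2)" for i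
    using a_step(1)[of i] a_step(1)[of "Suc i"] k[of i] k[of "Suc i"] k[of "Suc (Suc i)"]
      transD[of L "a (Suc (Suc (i + 2)))" "a (Suc (i + 2))" "a (i + 2)"]
      antisymD[of L "a (Suc (i + 2))" "a (i + 2)"]
    by (auto split: if_splits)
  from this[of "2 * i" for i] show ?thesis
    by (simp add: descending_sequence_def a_def add.commute)
qed


section \<open>Existence of jump hierarchies or descending sequences\<close>

lemma ex_jump_hierarchy:
  assumes wf: "wf (N - Id)" and z: "z \<in> Field N" "\<And>a. a \<in> Field N \<Longrightarrow> (z, a) \<in> N"
  shows "\<exists>X. jump_hierarchy N A X"
proof -
  define F where "F X b = (if b \<notin> Field N then {} else if b = z then A
      else turing_jump (join_below N X b))" for X :: "nat \<Rightarrow> nat set" and b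
  define X where "X = wfrec (N - Id) F"
  have X: "X b = F X b" for b
  proof -
    have "X b = F (cut X (N - Id) b) b"
      unfolding X_def by (rule wfrec[OF wf])
    \<comment> \<open>The join consults strict predecessors only, where \<open>cut\<close> changes
      nothing.\<close>
    also have "join_below N (cut X (N - Id) b) b = join_below N X b"
      unfolding join_below_def by (auto simp: cut_apply)
    then have "F (cut X (N - Id) b) b = F X b"
      by (simp add: F_def)
    finally show ?thesis .
  qed
  have "jump_hierarchy N A X"
    unfolding jump_hierarchy_def using z by (auto simp: X F_def intro!: bexI[of _ z])
  then show ?thesis by blast
qed

lemma ex_descending_sequence:
  assumes "\<not> wf (N - Id)"
  shows "\<exists>s. descending_sequence N s"
  using assms unfolding wf_iff_no_infinite_down_chain descending_sequence_def by auto

section \<open>The stages as a recursion along the jump hierarchy\<close>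

abbreviation cell :: "nat \<Rightarrow> nat \<Rightarrow> nat" where "cell k a \<equiv> prod_encode (k, a)"

text \<open>
  A name of a pair of orderings stores the first one at the even and the second one at the odd
  positions.
\<close>

definition fst_order :: "baire \<Rightarrow> nat rel" where
  "fst_order p = {(a, b). p (2 * prod_encode (a, b)) = 1}"

definition snd_order :: "baire \<Rightarrow> nat rel" where
  "snd_order p = {(a, b). p (2 * prod_encode (a, b) + 1) = 1}"

text \<open>
  \<open>clause R T x n w\<close> says that \<open>w\<close> witnesses the \<open>\<Sigma>\<^sub>1\<close> definition of \<open>T x n\<close> from the values of
  \<open>T\<close> at earlier stages; \<open>R\<close> stands for the set named by the instance.
\<close>

definition clause :: "(nat \<Rightarrow> bool) \<Rightarrow> (nat \<Rightarrow> nat \<Rightarrow> bool) \<Rightarrow> nat \<Rightarrow> nat \<Rightarrow> nat \<Rightarrow> bool" where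
  "clause R T x n w \<longleftrightarrow>
     (if pi1 x = 1 then R (2 * prod_encode (w, pi2 x)) \<and> w \<noteq> pi2 x \<and> \<not> T (cell 2 w) n
      else if pi1 x = 2 then \<not> R (2 * prod_encode (n, n) + 1) \<or> T (cell 1 (pi2 x)) n \<or>
        (R (2 * prod_encode (w, n) + 1) \<and> w \<noteq> n \<and> \<not> T (cell 1 (pi2 x)) w)
      else if pi1 x = 3 then \<not> T (cell 2 n) w
      else R (2 * prod_encode (pi1 w, pi1 w)) \<and> \<not> T (cell 3 0) (pi1 w) \<and>
        (n = 0 \<or> (R (2 * prod_encode (pi2 w, pi2 w) + 1) \<and> \<not> T (cell 1 (pi1 w)) (pi2 w))))"

text \<open>\<open>Y\<close> will be the join of the earlier stages: its column 0 answers
  \<open>R\<close>, and its column \<open>y\<close> answers \<open>T y\<close> through the same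
  index \<open>k\<close>.\<close>

lemma stage_recursion:
  obtains k where
    "\<And>Y x n. index k (prod_encode (x, n)) \<in> turing_jump Y \<longleftrightarrow>
       (\<exists>w. clause (\<lambda>m. prod_encode (0, m) \<in> Y)
          (\<lambda>y m. prod_encode (y, index k (prod_encode (y, m))) \<in> Y) x n w)"
proof -
  define P where "P p k z w \<longleftrightarrow> clause (\<lambda>m. p (prod_encode (prod_encode (0, 0), m)) = 1)
      (\<lambda>y m. p (prod_encode (y, index k (prod_encode (y, m)))) = 1) (pi1 z) (pi2 z) w" for p :: baire and k z w
  have "decidable_on UNIV (\<lambda>p z. P p (pi1 (pi1 z)) (pi2 (pi1 z)) (pi2 z))"
    unfolding P_def clause_def by (intro recursive_intros recursive_on_index)
  then obtain e where e: "\<And>Y n. index (code e) n \<in> turing_jump Y \<longleftrightarrow> (\<exists>w. P (char_fun Y) (code e) n w)"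
    using jump_recursion[of P] by blast
  have "(char_fun Y m = 1) = (m \<in> Y)" for Y m
    by (simp add: char_fun_def)
  moreover have "prod_encode (0, 0) = 0"
    by (simp add: prod_encode_def)
  ultimately show ?thesis
    using that[of "code e"] e unfolding P_def by simp
qed

text \<open>The hierarchy may live on an ill-founded ordering; everything below follows from its
  stage-by-stage equations.\<close>

locale comparison_hierarchy =
  fixes p :: baire and X :: "nat \<Rightarrow> nat set" and k :: nat
  assumes L: "Linear_order (fst_order p)" and M: "Linear_order (snd_order p)"
    and X: "jump_hierarchy (stages (fst_order p)) {n. p n = 1} X"
    and k: "\<And>Y x n. index k (prod_encode (x, n)) \<in> turing_jump Y \<longleftrightarrow>
       (\<exists>w. clause (\<lambda>m. prod_encode (0, m) \<in> Y)
          (\<lambda>y m. prod_encode (y, index k (prod_encode (y, m))) \<in> Y) x n w)"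
begin

definition T :: "nat \<Rightarrow> nat \<Rightarrow> bool" where
  "T x n \<longleftrightarrow> index k (prod_encode (x, n)) \<in> X x"

abbreviation less_stage :: "nat \<Rightarrow> nat \<Rightarrow> bool" where
  "less_stage y x \<equiv> (y, x) \<in> stages (fst_order p) \<and> y \<noteq> x"

lemma cell_0_0: "cell 0 0 = 0"
  by (simp add: prod_encode_def)

text \<open>Antisymmetry identifies the first stage with 0, so column 0 of the join is the instance.
  A query to a stage not strictly below \<open>x\<close> reads as false, because its column is
  empty.\<close>

lemma T_iff:
  assumes x: "stage (fst_order p) x" "x \<noteq> 0"
  shows "T x n \<longleftrightarrow>
    (\<exists>w. clause (\<lambda>m. p m = 1) (\<lambda>y m. less_stage y x \<and> T y m) x n w)"
proof -
  let ?N = "stages (fst_order p)"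
  obtain z where "z \<in> Field ?N" "\<forall>a\<in>Field ?N. (z, a) \<in> ?N" "X z = {n. p n = 1}"
    "\<forall>b\<in>Field ?N. b \<noteq> z \<longrightarrow> X b = turing_jump (join_below ?N X b)"
    using X unfolding jump_hierarchy_def by (elim conjE bexE)
  then have z: "z \<in> Field ?N" "\<And>a. a \<in> Field ?N \<Longrightarrow> (z, a) \<in> ?N" "X z = {n. p n = 1}"
    and jump: "\<And>b. b \<in> Field ?N \<Longrightarrow> b \<noteq> z \<Longrightarrow> X b = turing_jump (join_below ?N X b)"
    by simp_all
  have "stage (fst_order p) (cell 0 0)"
    by (simp add: stage_def)
  then have "stage (fst_order p) 0"
    by (simp only: cell_0_0)
  then have "(z, 0) \<in> ?N" "(0, z) \<in> ?N"
    using z stages_least[unfolded cell_0_0] by (auto simp: Field_stages)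
  then have "z = 0"
    using Linear_order_stages[OF L] unfolding order_on_defs by (blast dest: antisymD)
  have "prod_encode (0, m) \<in> join_below ?N X x \<longleftrightarrow> p m = 1" for m
    using stages_least[OF x(1), unfolded cell_0_0] x(2) z(3) \<open>z = 0\<close> by (auto simp: join_below_def)
  moreover have "prod_encode (y, index k (prod_encode (y, m))) \<in> join_below ?N X x
      \<longleftrightarrow> less_stage y x \<and> T y m" for y m
    by (auto simp: join_below_def T_def)
  ultimately show ?thesis
    using jump[of x] x \<open>z = 0\<close> unfolding T_def by (simp add: Field_stages k)
qed

lemma order_iff:
  "p (2 * prod_encode (a, b)) = Suc 0 \<longleftrightarrow> (a, b) \<in> fst_order p"
  "p (Suc (2 * prod_encode (a, b))) = Suc 0 \<longleftrightarrow> (a, b) \<in> snd_order p"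
  by (simp_all add: fst_order_def snd_order_def)

lemma refl_iff:
  "(a, a) \<in> fst_order p \<longleftrightarrow> a \<in> Field (fst_order p)"
  "(c, c) \<in> snd_order p \<longleftrightarrow> c \<in> Field (snd_order p)"
  using L M unfolding order_on_defs by (auto simp: refl_on_def intro: FieldI1)

lemma cell_neq_0: "i \<noteq> 0 \<Longrightarrow> 0 < cell i a"
  using cell_0_0 by (metis prod_encode_eq prod.inject gr0I)

lemma less_stage_iff:
  "less_stage (cell i a) (cell j b) \<longleftrightarrow> stage (fst_order p) (cell i a) \<and> stage (fst_order p) (cell j b) \<and>
     (if (i = 1 \<or> i = 2) \<and> (j = 1 \<or> j = 2)
      then if a = b then i < j else (a, b) \<in> fst_order p
      else i < j)"
  by (auto simp: stages_def stage_less_eq_def stage_def)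

lemma stage_cell:
  "i \<in> {1, 2} \<Longrightarrow> stage (fst_order p) (cell i a) \<longleftrightarrow> a \<in> Field (fst_order p)"
  "i \<in> {3, 4} \<Longrightarrow> stage (fst_order p) (cell i 0)"
  by (auto simp: stage_def refl_iff)

lemma T_1:
  assumes "a \<in> Field (fst_order p)"
  shows "T (cell 1 a) c \<longleftrightarrow> (\<exists>b. (b, a) \<in> fst_order p \<and> b \<noteq> a \<and> \<not> T (cell 2 b) c)"
proof -
  have "(b, a) \<in> fst_order p \<Longrightarrow> b \<in> Field (fst_order p)" for b
    by (rule FieldI1)
  then show ?thesis
    using assms T_iff[of "cell 1 a" c] cell_neq_0[of 1 a] less_stage_iff[of 2 _ 1 a]
      stage_cell(1)[of 1 a] stage_cell(1)[of 2]
    by (auto simp: clause_def order_iff)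
qed

lemma T_2:
  assumes "a \<in> Field (fst_order p)"
  shows "T (cell 2 a) c \<longleftrightarrow> c \<notin> Field (snd_order p) \<or> T (cell 1 a) c \<or>
    (\<exists>d. (d, c) \<in> snd_order p \<and> d \<noteq> c \<and> \<not> T (cell 1 a) d)"
  using assms T_iff[of "cell 2 a" c] cell_neq_0[of 2 a] less_stage_iff[of 1 a 2 a]
    stage_cell(1)[of 1 a] stage_cell(1)[of 2 a]
  by (auto simp: clause_def order_iff refl_iff)

lemma T_3:
  assumes "a \<in> Field (fst_order p)"
  shows "T (cell 3 0) a \<longleftrightarrow> (\<exists>c. \<not> T (cell 2 a) c)"
  using assms T_iff[of "cell 3 0" a] cell_neq_0[of 3 0] less_stage_iff[of 2 a 3 0]
    stage_cell(1)[of 2 a] stage_cell(2)[of 3]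
  by (auto simp: clause_def)

text \<open>At 0 this asks whether the comparison map is undefined somewhere; at 1, whether this
  happens before the second ordering is exhausted.\<close>

lemma T_4:
  "T (cell 4 0) n \<longleftrightarrow> (\<exists>a\<in>Field (fst_order p). \<not> T (cell 3 0) a \<and>
     (n = 0 \<or> (\<exists>c\<in>Field (snd_order p). \<not> T (cell 1 a) c)))"
proof -
  have "T (cell 4 0) n \<longleftrightarrow> (\<exists>w. pi1 w \<in> Field (fst_order p) \<and> \<not> T (cell 3 0) (pi1 w) \<and>
     (n = 0 \<or> (pi2 w \<in> Field (snd_order p) \<and> \<not> T (cell 1 (pi1 w)) (pi2 w))))"
    using T_iff[of "cell 4 0" n] cell_neq_0[of 4 0] less_stage_iff[of 1 _ 4 0]
      less_stage_iff[of 3 0 4 0] stage_cell(1)[of 1] stage_cell(2)[of 3] stage_cell(2)[of 4]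
    by (auto simp: clause_def order_iff refl_iff)
  also have "\<dots> \<longleftrightarrow> (\<exists>a c. a \<in> Field (fst_order p) \<and> \<not> T (cell 3 0) a \<and>
     (n = 0 \<or> (c \<in> Field (snd_order p) \<and> \<not> T (cell 1 a) c)))"
    by (metis fst_conv snd_conv prod_encode_inverse)
  finally show ?thesis by blast
qed

sublocale comparison "fst_order p" "snd_order p" "\<lambda>a. T (cell 1 a)" "\<lambda>a c. \<not> T (cell 2 a) c"
  by standard (use L M T_1 T_2 in auto)

end

section \<open>The reduction\<close>

text \<open>The name \<open>p\<close> of a pair of orderings is itself a characteristic function and
  serves as the starting set.\<close>

definition stages_name :: "baire \<Rightarrow> baire" where
  "stages_name p n =
     (if n mod 2 = 0
      then if stage_less_eq (fst_order p) (pi1 (n div 2)) (pi2 (n div 2)) then 1 else 0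
      else p (n div 2))"

lemma decidable_on_fst_order:
  assumes "recursive_on S F" "recursive_on S G"
  shows "decidable_on S (\<lambda>p x. (F p x, G p x) \<in> fst_order p)"
  unfolding fst_order_def mem_Collect_eq case_prod_conv by (intro recursive_intros assms)

lemma recursive_on_stages_name: "recursive_on UNIV stages_name"
  unfolding stages_name_def stage_less_eq_def stage_def
  by (intro recursive_intros decidable_on_fst_order)

text \<open>The oracle is \<open>r = p \<oplus> q\<close> with \<open>p\<close> naming the instance and \<open>q\<close> a solution of \<open>ATR2\<close>.\<close>

definition instance_part :: "baire \<Rightarrow> baire" where
  "instance_part r n = r (2 * n)"

text \<open>Odd positions of \<open>r\<close> hold \<open>q\<close>, and \<open>Suc\<close> skips
  the tag \<open>q 0\<close>; the entry read decides membership of the index in the set at stage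
  \<open>x\<close>.\<close>

definition answer :: "nat \<Rightarrow> baire \<Rightarrow> nat \<Rightarrow> nat \<Rightarrow> bool" where
  "answer k r x n \<longleftrightarrow> r (2 * Suc (prod_encode (x, index k (prod_encode (x, n)))) + 1) = 1"

abbreviation ord1 :: "baire \<Rightarrow> nat rel" where "ord1 r \<equiv> fst_order (instance_part r)"
abbreviation ord2 :: "baire \<Rightarrow> nat rel" where "ord2 r \<equiv> snd_order (instance_part r)"

lemma decidable_on_ord:
  assumes "recursive_on S F" "recursive_on S G"
  shows "decidable_on S (\<lambda>r x. (F r x, G r x) \<in> ord1 r)"
    and "decidable_on S (\<lambda>r x. (F r x, G r x) \<in> ord2 r)"
  unfolding fst_order_def snd_order_def instance_part_def mem_Collect_eq case_prod_conv
  by (intro recursive_intros assms)+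

lemma decidable_on_answer:
  assumes "recursive_on S F" "recursive_on S G"
  shows "decidable_on S (\<lambda>r x. answer k r (F r x) (G r x))"
  unfolding answer_def by (intro recursive_intros recursive_on_index assms)

lemmas decidable_intros = recursive_intros decidable_on_ord decidable_on_answer

section \<open>The backward functional\<close>

definition tagged :: "nat \<Rightarrow> nat \<Rightarrow> baire \<Rightarrow> baire" where
  "tagged i j h n = (if n = 0 then i else if n = 1 then j else h (n - 2))"

lemma recursive_on_tagged:
  assumes "recursive_on S F"
  shows "recursive_on S (\<lambda>r. tagged i j (F r))"
  unfolding tagged_def by (intro recursive_intros recursive_on_comp[OF assms])

definition stage_descent :: "baire \<Rightarrow> baire" where
  "stage_descent r i = pi2 (r (2 * Suc (2 * i + 2) + 1))"

text \<open>\<open>Suc\<close> is needed because names of partial maps reserve 0 for undefined.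
  Outside the field the implication holds at once and the search stops at 0.\<close>

definition embed12 :: "nat \<Rightarrow> baire \<Rightarrow> baire" where
  "embed12 k r a =
     (if (a, a) \<in> ord1 r then Suc (LEAST c. (a, a) \<in> ord1 r \<longrightarrow> \<not> answer k r (cell 2 a) c) else 0)"

definition embed21 :: "nat \<Rightarrow> baire \<Rightarrow> baire" where
  "embed21 k r c =
     (if (c, c) \<in> ord2 r
      then Suc (LEAST a. (c, c) \<in> ord2 r \<longrightarrow> (a, a) \<in> ord1 r \<and> \<not> answer k r (cell 2 a) c) else 0)"

definition stuck :: "nat \<Rightarrow> baire \<Rightarrow> nat \<Rightarrow> nat \<Rightarrow> bool" where
  "stuck k r a c \<longleftrightarrow> (a, a) \<in> ord1 r \<and> \<not> answer k r (cell 3 0) a \<and>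
     (c, c) \<in> ord2 r \<and> \<not> answer k r (cell 1 a) c"

definition stuck_start :: "nat \<Rightarrow> baire \<Rightarrow> nat" where
  "stuck_start k r = (LEAST w. stuck k r (pi1 w) (pi2 w))"

definition stuck_next :: "nat \<Rightarrow> baire \<Rightarrow> nat \<Rightarrow> nat \<Rightarrow> nat" where
  "stuck_next k r a c =
     (LEAST d. stuck k r a c \<longrightarrow> (d, c) \<in> ord2 r \<and> d \<noteq> c \<and> \<not> answer k r (cell 1 a) d)"

definition stuck_descent :: "nat \<Rightarrow> baire \<Rightarrow> baire" where
  "stuck_descent k r i =
     rec_nat (pi2 (stuck_start k r)) (\<lambda>n c. stuck_next k r (pi1 (stuck_start k r)) c) i"

text \<open>\<open>r 1\<close> is the tag of the \<open>ATR2\<close> solution. Each search is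
  reached only after the tests that guarantee its termination.\<close>

definition solve :: "nat \<Rightarrow> baire \<Rightarrow> baire" where
  "solve k r =
     (if r 1 = 0 then tagged 1 0 (stage_descent r)
      else if answer k r (cell 4 0) 1 then tagged 1 1 (stuck_descent k r)
      else if answer k r (cell 4 0) 0 then tagged 0 1 (embed21 k r)
      else tagged 0 0 (embed12 k r))"

text \<open>The promise for the searches: the answers come from an actual jump hierarchy.\<close>

definition hierarchy_oracles :: "nat \<Rightarrow> baire set" where
  "hierarchy_oracles k = {r. \<exists>X. comparison_hierarchy (instance_part r) X k \<and>
     (\<forall>x n. answer k r x n \<longleftrightarrow> comparison_hierarchy.T X k x n)}"

lemma hierarchy_oraclesE:
  assumes "r \<in> hierarchy_oracles k"
  obtains "comparison (ord1 r) (ord2 r) (\<lambda>a. answer k r (cell 1 a)) (\<lambda>a c. \<not> answer k r (cell 2 a) c)"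
    and "\<And>a. a \<in> Field (ord1 r) \<Longrightarrow> answer k r (cell 3 0) a \<longleftrightarrow> (\<exists>c. \<not> answer k r (cell 2 a) c)"
    and "\<And>n. answer k r (cell 4 0) n \<longleftrightarrow> (\<exists>a\<in>Field (ord1 r). \<not> answer k r (cell 3 0) a \<and>
     (n = 0 \<or> (\<exists>c\<in>Field (ord2 r). \<not> answer k r (cell 1 a) c)))"
    and "\<And>a. (a, a) \<in> ord1 r \<longleftrightarrow> a \<in> Field (ord1 r)"
    and "\<And>c. (c, c) \<in> ord2 r \<longleftrightarrow> c \<in> Field (ord2 r)"
proof -
  obtain X where "comparison_hierarchy (instance_part r) X k"
    and "\<forall>x n. answer k r x n \<longleftrightarrow> comparison_hierarchy.T X k x n"
    using assms unfolding hierarchy_oracles_def by blast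
  then interpret comparison_hierarchy "instance_part r" X k
    rewrites "comparison_hierarchy.T X k \<equiv> answer k r"
    by (auto intro!: eq_reflection ext)
  show thesis
    by (rule that) (use comparison_axioms T_3 T_4 refl_iff in auto)
qed

section \<open>Termination of the searches\<close>

lemma ex_embed12:
  assumes "r \<in> hierarchy_oracles k" "\<not> answer k r (cell 4 0) 0"
  shows "\<exists>c. (a, a) \<in> ord1 r \<longrightarrow> \<not> answer k r (cell 2 a) c"
  using assms(1) by (rule hierarchy_oraclesE) (use assms(2) in blast)

lemma stuckD:
  assumes "r \<in> hierarchy_oracles k" "stuck k r a c"
  shows "\<exists>d. (d, c) \<in> ord2 r \<and> d \<noteq> c \<and> \<not> answer k r (cell 1 a) d"
  using assms(1)
proof (rule hierarchy_oraclesE)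
  assume c: "comparison (ord1 r) (ord2 r) (\<lambda>a. answer k r (cell 1 a)) (\<lambda>a c. \<not> answer k r (cell 2 a) c)"
    and "\<And>a. a \<in> Field (ord1 r) \<Longrightarrow> answer k r (cell 3 0) a \<longleftrightarrow> (\<exists>c. \<not> answer k r (cell 2 a) c)"
    and "\<And>a. (a, a) \<in> ord1 r \<longleftrightarrow> a \<in> Field (ord1 r)"
    and "\<And>c. (c, c) \<in> ord2 r \<longleftrightarrow> c \<in> Field (ord2 r)"
  then show ?thesis
    using comparison.not_least[OF c, of a c] assms(2) unfolding stuck_def by blast
qed

lemma ex_stuck:
  assumes "r \<in> hierarchy_oracles k" "answer k r (cell 4 0) 1"
  shows "\<exists>w. stuck k r (pi1 w) (pi2 w)"
  using assms(1)
proof (rule hierarchy_oraclesE)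
  assume "\<And>n. answer k r (cell 4 0) n \<longleftrightarrow> (\<exists>a\<in>Field (ord1 r). \<not> answer k r (cell 3 0) a \<and>
     (n = 0 \<or> (\<exists>c\<in>Field (ord2 r). \<not> answer k r (cell 1 a) c)))"
    and "\<And>a. (a, a) \<in> ord1 r \<longleftrightarrow> a \<in> Field (ord1 r)"
    and "\<And>c. (c, c) \<in> ord2 r \<longleftrightarrow> c \<in> Field (ord2 r)"
  then obtain a c where "stuck k r a c"
    using assms(2) unfolding stuck_def by force
  then show ?thesis by (intro exI[of _ "cell a c"]) simp
qed

lemma not_stuckD:
  assumes "r \<in> hierarchy_oracles k" "\<not> answer k r (cell 4 0) 1"
    and "a \<in> Field (ord1 r)" "\<nexists>c. \<not> answer k r (cell 2 a) c" "c \<in> Field (ord2 r)"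
  shows "answer k r (cell 1 a) c"
  using assms(1) by (rule hierarchy_oraclesE) (use assms(2-) in blast)

text \<open>Take a point where the map is undefined. As nothing is stuck, every element of the
  second ordering was used before that point.\<close>

lemma ex_embed21:
  assumes r: "r \<in> hierarchy_oracles k"
    and v: "\<not> answer k r (cell 4 0) 1" "answer k r (cell 4 0) 0"
  shows "\<exists>a. (c, c) \<in> ord2 r \<longrightarrow> (a, a) \<in> ord1 r \<and> \<not> answer k r (cell 2 a) c"
  using r
proof (rule hierarchy_oraclesE)
  assume c: "comparison (ord1 r) (ord2 r) (\<lambda>a. answer k r (cell 1 a)) (\<lambda>a c. \<not> answer k r (cell 2 a) c)"
    and v3: "\<And>a. a \<in> Field (ord1 r) \<Longrightarrow> answer k r (cell 3 0) a \<longleftrightarrow> (\<exists>c. \<not> answer k r (cell 2 a) c)"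
    and v4: "\<And>n. answer k r (cell 4 0) n \<longleftrightarrow> (\<exists>a\<in>Field (ord1 r). \<not> answer k r (cell 3 0) a \<and>
     (n = 0 \<or> (\<exists>c\<in>Field (ord2 r). \<not> answer k r (cell 1 a) c)))"
    and refl: "\<And>a. (a, a) \<in> ord1 r \<longleftrightarrow> a \<in> Field (ord1 r)"
      "\<And>c. (c, c) \<in> ord2 r \<longleftrightarrow> c \<in> Field (ord2 r)"
  obtain a where a: "a \<in> Field (ord1 r)" "\<nexists>c. \<not> answer k r (cell 2 a) c"
    using v(2) v3 v4 by blast
  show ?thesis
    using not_stuckD[OF r v(1) a, of c] comparison.U_iff[OF c a(1), of c] refl
    by (meson FieldI1)
qed

text \<open>The branches are combined lazily, since each search is total only on the oracles that
  pass the preceding tests. With \<open>r 1 = 0\<close> there is no search, and no hierarchy is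
  required.\<close>

lemma recursive_on_solve: "recursive_on {r. r 1 = 0 \<or> r \<in> hierarchy_oracles k} (solve k)"
proof -
  let ?H = "hierarchy_oracles k"
  have 1: "recursive_on S stage_descent" for S
    unfolding stage_descent_def by (intro recursive_intros)
  have 2: "recursive_on {r \<in> ?H. answer k r (cell 4 0) 1} (stuck_descent k)" (is "recursive_on ?S _")
  proof -
    have dec: "decidable_on S (\<lambda>r x. stuck k r (F r x) (G r x))"
      if "recursive_on S F" "recursive_on S G" for S F G
      unfolding stuck_def by (intro decidable_intros that)
    have start: "recursive_on ?S (\<lambda>r x. stuck_start k r)"
      unfolding stuck_start_def
      by (rule recursive_on_Least) (intro dec decidable_intros, use ex_stuck in blast)
    have "recursive_on ?S (\<lambda>r x. stuck_next k r (pi1 x) (pi2 x))"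
      unfolding stuck_next_def imp_conv_disj
      by (rule recursive_on_Least) (intro dec decidable_intros, use stuckD in blast)
    from recursive_on_comp[OF this recursive_on_pair]
    have "next": "recursive_on ?S (\<lambda>r x. stuck_next k r (F r x) (G r x))"
      if "recursive_on ?S F" "recursive_on ?S G" for F G
      using that by simp
    then show ?thesis
      unfolding stuck_descent_def
      by (intro recursive_on_rec_nat "next" recursive_on_id recursive_on_pi1 recursive_on_pi2 start)
  qed
  have 3: "recursive_on {r \<in> ?H. \<not> answer k r (cell 4 0) 1 \<and> answer k r (cell 4 0) 0} (embed21 k)"
    unfolding embed21_def imp_conv_disj
    by (intro decidable_intros recursive_on_Least) (use ex_embed21 in blast)
  have 4: "recursive_on {r \<in> ?H. \<not> answer k r (cell 4 0) 1 \<and> \<not> answer k r (cell 4 0) 0} (embed12 k)"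
    unfolding embed12_def imp_conv_disj
    by (intro decidable_intros recursive_on_Least) (use ex_embed12 in blast)
  have sub: "recursive_on S' F" if "recursive_on S F" "S' \<subseteq> S" for S S' F
    using that unfolding recursive_on_def by blast
  show ?thesis
    unfolding solve_def
    by (intro recursive_on_branch recursive_on_tagged decidable_intros 1 sub[OF 2] sub[OF 3] sub[OF 4])
      auto
qed

text \<open>The point \<open>a\<close> stays fixed, and being stuck is the invariant that keeps the
  descent going.\<close>

lemma descending_sequence_stuck_descent:
  assumes r: "r \<in> hierarchy_oracles k" "answer k r (cell 4 0) 1"
  shows "descending_sequence (ord2 r) (stuck_descent k r)"
proof -
  define a where "a = pi1 (stuck_start k r)"
  have next_c: "(stuck_next k r a c, c) \<in> ord2 r \<and> stuck_next k r a c \<noteq> c \<and>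
      \<not> answer k r (cell 1 a) (stuck_next k r a c)" if "stuck k r a c" for c
    using LeastI_ex[OF stuckD[OF r(1) that]] that unfolding stuck_next_def by simp
  have stuck: "stuck k r a (stuck_descent k r i)" for i
  proof (induction i)
    case 0
    then show ?case
      using LeastI_ex[OF ex_stuck[OF r]] by (simp add: a_def stuck_descent_def stuck_start_def)
  next
    case (Suc i)
    have "(c, c) \<in> ord2 r \<longleftrightarrow> c \<in> Field (ord2 r)" for c
      using r(1) by (rule hierarchy_oraclesE)
    then show ?case
      using next_c[OF Suc] Suc unfolding stuck_descent_def a_def[symmetric]
      by (auto simp: stuck_def intro: FieldI1)
  qed
  show ?thesis
    unfolding descending_sequence_def
    using next_c[OF stuck] by (simp add: stuck_descent_def a_def)
qed

definition map_of_name :: "baire \<Rightarrow> nat \<rightharpoonup> nat" where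
  "map_of_name h n = (case h n of 0 \<Rightarrow> None | Suc m \<Rightarrow> Some m)"

lemma initial_embedding_embed12:
  assumes r: "r \<in> hierarchy_oracles k" "\<not> answer k r (cell 4 0) 0"
  shows "initial_embedding (ord1 r) (ord2 r) (map_of_name (embed12 k r))"
  using r(1)
proof (rule hierarchy_oraclesE)
  assume c: "comparison (ord1 r) (ord2 r) (\<lambda>a. answer k r (cell 1 a)) (\<lambda>a c. \<not> answer k r (cell 2 a) c)"
    and refl: "\<And>a. (a, a) \<in> ord1 r \<longleftrightarrow> a \<in> Field (ord1 r)"
  show ?thesis
  proof (rule comparison.initial_embedding_LM[OF c])
    show "dom (map_of_name (embed12 k r)) = Field (ord1 r)"
      by (auto simp: map_of_name_def embed12_def dom_def refl split: if_splits)
    show "\<not> answer k r (cell 2 a) (the (map_of_name (embed12 k r) a))" if "a \<in> Field (ord1 r)" for a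
      using LeastI_ex[OF ex_embed12[OF r, of a]] that by (simp add: map_of_name_def embed12_def refl)
  qed
qed

lemma initial_embedding_embed21:
  assumes r: "r \<in> hierarchy_oracles k"
    and v: "\<not> answer k r (cell 4 0) 1" "answer k r (cell 4 0) 0"
  shows "initial_embedding (ord2 r) (ord1 r) (map_of_name (embed21 k r))"
  using r
proof (rule hierarchy_oraclesE)
  assume c: "comparison (ord1 r) (ord2 r) (\<lambda>a. answer k r (cell 1 a)) (\<lambda>a c. \<not> answer k r (cell 2 a) c)"
    and refl: "\<And>a. (a, a) \<in> ord1 r \<longleftrightarrow> a \<in> Field (ord1 r)"
      "\<And>c. (c, c) \<in> ord2 r \<longleftrightarrow> c \<in> Field (ord2 r)"
  show ?thesis
  proof (rule comparison.initial_embedding_ML[OF c])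
    show "dom (map_of_name (embed21 k r)) = Field (ord2 r)"
      by (auto simp: map_of_name_def embed21_def dom_def refl split: if_splits)
    show "the (map_of_name (embed21 k r) c) \<in> Field (ord1 r) \<and>
        \<not> answer k r (cell 2 (the (map_of_name (embed21 k r) c))) c" if "c \<in> Field (ord2 r)" for c
      using LeastI_ex[OF ex_embed21[OF r v, of c]] that
      by (simp add: map_of_name_def embed21_def refl)
    show "answer k r (cell 1 a) c"
      if "a \<in> Field (ord1 r)" "\<nexists>c. \<not> answer k r (cell 2 a) c" "c \<in> Field (ord2 r)" for a c
      using not_stuckD[OF r v(1) that] .
  qed
qed

section \<open>Names of instances and solutions\<close>

lemma sol_rep_CWO2_tagged:
  "sol_rep CWO2 (tagged 0 0 h) = Some (Inl (Inl (map_of_name h)))"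
  "sol_rep CWO2 (tagged 0 1 h) = Some (Inl (Inr (map_of_name h)))"
  "sol_rep CWO2 (tagged 1 0 h) = Some (Inr (Inl h))"
  "sol_rep CWO2 (tagged 1 1 h) = Some (Inr (Inr h))"
  by (simp_all add: CWO2_def rep_sum_def tagged_def rep_map_def rep_baire_def map_of_name_def[abs_def])

lemma rep_linear_order_eq_Some:
  "rep_linear_order p = Some L \<longleftrightarrow>
     range p \<subseteq> {0, 1} \<and> L = {(a, b). p (prod_encode (a, b)) = 1} \<and> Linear_order L"
  by (auto simp: rep_linear_order_def rep_set_def Let_def split: if_splits)

lemma inst_rep_CWO2_eq_Some:
  "inst_rep CWO2 p = Some (L, M) \<longleftrightarrow> range p \<subseteq> {0, 1} \<and> L = fst_order p \<and> M = snd_order p \<and>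
     Linear_order L \<and> Linear_order M"
proof -
  have "(\<forall>n. Q n) \<longleftrightarrow> (\<forall>n. Q (2 * n)) \<and> (\<forall>n. Q (2 * n + 1))" for Q :: "nat \<Rightarrow> bool"
    by (metis oddE evenE)
  from this[of "\<lambda>n. p n \<in> {0, 1}"]
  have "range p \<subseteq> {0, 1} \<longleftrightarrow> range (\<lambda>n. p (2 * n)) \<subseteq> {0, 1} \<and> range (\<lambda>n. p (2 * n + 1)) \<subseteq> {0, 1}"
    by (simp only: image_subset_iff ball_UNIV)
  then show ?thesis
    by (auto simp: CWO2_def rep_prod_def bind_eq_Some_conv rep_linear_order_eq_Some
        fst_order_def snd_order_def)
qed

lemma inst_rep_ATR2_stages_name:
  assumes "inst_rep CWO2 p = Some (L, M)"
  shows "inst_rep ATR2 (stages_name p) = Some (stages L, {n. p n = 1})"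
proof -
  have p: "range p \<subseteq> {0, 1}" "L = fst_order p" "Linear_order L"
    using assms by (auto simp: inst_rep_CWO2_eq_Some)
  have "rep_linear_order (\<lambda>n. stages_name p (2 * n)) = Some (stages L)"
    using Linear_order_stages[OF p(3)]
    by (auto simp: rep_linear_order_eq_Some stages_name_def stages_def p(2))
  moreover have "rep_set (\<lambda>n. stages_name p (2 * n + 1)) = Some {n. p n = 1}"
    using p(1) by (simp add: rep_set_def stages_name_def image_subset_iff)
  ultimately show ?thesis by (simp add: ATR2_def rep_prod_def)
qed

text \<open>Solvability is a purely classical matter: recursion along a well-founded ordering of
  stages, or else a descending sequence.\<close>

lemma names_instance_stages_name:
  assumes p: "inst_rep CWO2 p = Some (L, M)"
  shows "names_instance ATR2 (stages_name p)"
proof -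
  have "\<exists>y. y \<in> solutions ATR2 (stages L, {n. p n = 1}) \<and> y \<in> ran (sol_rep ATR2)"
  proof (cases "wf (stages L - Id)")
    case True
    have "stage L (cell 0 0)" by (simp add: stage_def)
    then obtain X where X: "jump_hierarchy (stages L) {n. p n = 1} X"
      using ex_jump_hierarchy[OF True, of "cell 0 0"] stages_least unfolding Field_stages by blast
    \<comment> \<open>The tag 1 of the right summand, followed by the characteristic function of the
      family.\<close>
    define q where "q = (\<lambda>n. case n of 0 \<Rightarrow> 1 | Suc m \<Rightarrow> if pi2 m \<in> X (pi1 m) then 1 else (0::nat))"
    have "sol_rep ATR2 q = Some (Inr X)"
      by (auto simp: ATR2_def rep_sum_def rep_family_def rep_set_def q_def)
    with X show ?thesis by (auto simp: ATR2_def ran_def)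
  next
    case False
    then obtain s where s: "descending_sequence (stages L) s" using ex_descending_sequence by blast
    have "sol_rep ATR2 (\<lambda>n. case n of 0 \<Rightarrow> 0 | Suc m \<Rightarrow> s m) = Some (Inl s)"
      by (simp add: ATR2_def rep_sum_def rep_baire_def)
    with s show ?thesis by (auto simp: ATR2_def ran_def)
  qed
  then show ?thesis
    unfolding names_instance_def using inst_rep_ATR2_stages_name[OF p] by blast
qed

lemma names_solution_ATR2_cases:
  assumes p: "inst_rep CWO2 p = Some (L, M)"
    and q: "names_solution ATR2 (stages_name p) q"
  obtains "q 0 = 0" "descending_sequence (stages L) (\<lambda>n. q (Suc n))"
  | "q 0 = 1" "jump_hierarchy (stages L) {n. p n = 1} (\<lambda>a. {x. q (Suc (prod_encode (a, x))) = 1})"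
  using q unfolding names_solution_def inst_rep_ATR2_stages_name[OF p]
  by (auto simp: ATR2_def rep_sum_def rep_baire_def rep_family_def rep_set_def split: if_splits)

theorem theorem8p12:
  shows "CWO2 \<le>\<^sub>W ATR2"
proof -
  \<comment> \<open>The index is fixed before any instance is given, so the backward functional is
    uniform.\<close>
  obtain k where k: "\<And>Y x n. index k (prod_encode (x, n)) \<in> turing_jump Y \<longleftrightarrow>
       (\<exists>w. clause (\<lambda>m. prod_encode (0, m) \<in> Y)
          (\<lambda>y m. prod_encode (y, index k (prod_encode (y, m))) \<in> Y) x n w)"
    by (rule stage_recursion) blast
  \<comment> \<open>Every relevant join lies in \<open>S\<close>: through its tag if
    \<open>q\<close> is a descending sequence, through its hierarchy otherwise.\<close>
  define S where "S = {r. r 1 = 0 \<or> r \<in> hierarchy_oracles k}"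
  let ?\<Phi> = "\<lambda>p. if p \<in> UNIV then Some (stages_name p) else None"
  let ?\<Psi> = "\<lambda>r. if r \<in> S then Some (solve k r) else None"
  have "computable ?\<Phi>"
    by (rule computable_if_recursive_on[OF recursive_on_stages_name])
  moreover have "computable ?\<Psi>"
    unfolding S_def by (rule computable_if_recursive_on[OF recursive_on_solve])
  moreover have sol: "p \<oplus> q \<in> S \<and> names_solution CWO2 p (solve k (p \<oplus> q))"
    if p: "inst_rep CWO2 p = Some (L, M)" and q: "names_solution ATR2 (stages_name p) q" for p q L M
  proof -
    define r where "r = p \<oplus> q"
    have LM: "L = fst_order p" "M = snd_order p" "Linear_order L" "Linear_order M"
      using p by (auto simp: inst_rep_CWO2_eq_Some)
    have [simp]: "instance_part r = p"
      by (auto simp: instance_part_def r_def join_def)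
    have r1: "r 1 = q 0" and r_odd: "r (Suc (2 * n)) = q n" for n
      by (simp_all add: r_def join_def)
    have solution: "names_solution CWO2 p s \<longleftrightarrow>
        (\<exists>y. sol_rep CWO2 s = Some y \<and> y \<in> solutions CWO2 (L, M))" for s
      unfolding names_solution_def p by auto
    show ?thesis
      using p q
    proof (cases rule: names_solution_ATR2_cases)
      case 1
      have "stage_descent r = (\<lambda>i. pi2 (q (Suc (2 * i + 2))))"
        by (simp add: stage_descent_def fun_eq_iff r_odd del: mult_Suc_right)
      then have "descending_sequence L (stage_descent r)"
        using descending_sequence_stages[OF LM(3) 1(2)] by simp
      then show ?thesis
        using 1(1) r1 unfolding r_def[symmetric] solution S_def
        by (simp add: solve_def sol_rep_CWO2_tagged[simplified]) (simp add: CWO2_def)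
    next
      case 2
      define X where "X a = {x. q (Suc (prod_encode (a, x))) = 1}" for a
      interpret comparison_hierarchy p X k
        using 2(2) LM k unfolding X_def by unfold_locales auto
      have "answer k r x n \<longleftrightarrow> T x n" for x n
        by (simp add: answer_def T_def X_def r_odd del: mult_Suc_right)
      then have r: "r \<in> hierarchy_oracles k"
        unfolding hierarchy_oracles_def using comparison_hierarchy_axioms by auto
      have "names_solution CWO2 p (solve k r)"
        unfolding solution solve_def
        using r1 2(1) descending_sequence_stuck_descent[OF r] initial_embedding_embed12[OF r] initial_embedding_embed21[OF r] LM
        by (auto simp: sol_rep_CWO2_tagged[simplified]) (auto simp: CWO2_def)
      then show ?thesis using r by (simp add: r_def S_def)
    qed
  qed
  moreover have "\<exists>r. ?\<Phi> p = Some r \<and> names_instance ATR2 r \<and>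
      (\<forall>q. names_solution ATR2 r q \<longrightarrow> (\<exists>s. ?\<Psi> (p \<oplus> q) = Some s \<and> names_solution CWO2 p s))"
    if p: "names_instance CWO2 p" for p
  proof -
    obtain L M where p: "inst_rep CWO2 p = Some (L, M)"
      using p unfolding names_instance_def by auto
    show ?thesis
      using names_instance_stages_name[OF p] sol[OF p] by simp
  qed
  ultimately show ?thesis unfolding weihrauch_reducible_def by blast
qed

end
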